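(* Let $m\ge 1$ be an integer. Let $t_0$ be any point in $(-1,1)$ such that $U_{2m}(t_0)\neq 0$, and let $t_j=\cos\frac{2j\pi}{2m+1}$ for $j=1,2,\ldots,m$; put $\mathbf t=\{t_0,t_1,\ldots,t_m\}$. For $1\le j\le m-1$ let $X_j(t)\in\mathbb R^{m+1}$ be the column vector with entries $$U_{2m}(t),U_{2m-2}(t),\ldots,U_{2j}(t),\;U_{2m-1}(t),U_{2m-3}(t),\ldots,U_{2m-2j+1}(t),$$ and let $\Xi_j(\mathbf t)=[X_j(t_0),X_j(t_1),\ldots,X_j(t_m)]$. Then the $(m+1)\times(m+1)$ matrices $\Xi_1(\mathbf t),\Xi_2(\mathbf t),\ldots,\Xi_{m-1}(\mathbf t)$ are all nonsingular. Moreover, every polynomial $P\in\Pi_{2m}^2$ is uniquely determined by the set of its Radon projections $$\mathcal R_{\phi_{j,m}}(P;t_k),\qquad 0\le j\le 2m,\quad 0\le k\le m,\qquad \phi_{j,m}=\frac{2j\pi}{2m+1};$$ that is, if $P,Q\in\Pi_{2m}^2$ satisfy $\mathcal R_{\phi_{j,m}}(P;t_k)=\mathcal R_{\phi_{j,m}}(Q;t_k)$ for all $0\le j\le 2m$ and $0\le k\le m$, then $P=Q$.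
   Context: $\Pi_n^2$ is the space of real polynomials in two variables of total degree at most $n$. The Radon projection of a function $f$ on the closed unit disk in direction $\theta$ with parameter $t\in[-1,1]$ is $$\mathcal R_\theta(f;t)=\int_{-\sqrt{1-t^2}}^{\sqrt{1-t^2}} f(t\cos\theta-s\sin\theta,\;t\sin\theta+s\cos\theta)\,ds .$$ $U_k$ is the Chebyshev polynomial of the second kind, $U_k(\cos\theta)=\sin((k+1)\theta)/\sin\theta$. *)

theory Defs
  imports
    "HOL-Analysis.Analysis"
    "HOL-Computational_Algebra.Polynomial"
    "Jordan_Normal_Form.Matrix"
begin

text \<open>
  A polynomial in the two variables \<open>x\<close>, \<open>y\<close> is an element of \<open>\<real>[x][y]\<close>: the inner variable
  is \<open>x\<close>, the outer one is \<open>y\<close>, so \<open>coeff (coeff P i) j\<close> is the coefficient of \<open>x^j y^i\<close>.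
\<close>

definition eval2 :: "real poly poly \<Rightarrow> real \<times> real \<Rightarrow> real" where
  "eval2 P = (\<lambda>(x, y). poly (poly P [:y:]) x)"

definition Pi2 :: "nat \<Rightarrow> real poly poly set" where
  "Pi2 n = {P. \<forall>i j. coeff (coeff P i) j \<noteq> 0 \<longrightarrow> i + j \<le> n}"

lemma eval2_altdef:
  "eval2 P (x, y) = (\<Sum>i\<le>degree P. \<Sum>j\<le>degree (coeff P i). coeff (coeff P i) j * x ^ j * y ^ i)"
proof -
  have "poly (poly P [:y:]) x = (\<Sum>i\<le>degree P. poly (coeff P i) x * y ^ i)"
    by (subst poly_altdef) (simp add: poly_sum)
  also have "\<dots> = (\<Sum>i\<le>degree P. (\<Sum>j\<le>degree (coeff P i). coeff (coeff P i) j * x ^ j) * y ^ i)"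
    by (simp only: poly_altdef)
  finally show ?thesis by (simp add: eval2_def sum_distrib_right)
qed

definition radon :: "real \<Rightarrow> (real \<times> real \<Rightarrow> real) \<Rightarrow> real \<Rightarrow> real" where
  "radon \<theta> f t = integral {- sqrt (1 - t\<^sup>2)..sqrt (1 - t\<^sup>2)}
     (\<lambda>s. f (t * cos \<theta> - s * sin \<theta>, t * sin \<theta> + s * cos \<theta>))"

definition cheb_U :: "nat \<Rightarrow> real poly" where
  "cheb_U k = (THE p. \<forall>\<theta>. sin \<theta> \<noteq> 0 \<longrightarrow> poly p (cos \<theta>) = sin (real (k + 1) * \<theta>) / sin \<theta>)"

text \<open>The description is proper: such a polynomial exists and is unique.\<close>

lemma cheb_U_ex:
  "\<exists>p :: real poly. \<forall>\<theta>. sin \<theta> \<noteq> 0 \<longrightarrow> poly p (cos \<theta>) = sin (real (k + 1) * \<theta>) / sin \<theta>"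
proof (induction k rule: less_induct)
  case (less k)
  consider "k = 0" | "k = 1" | n where "k = n + 2"
  proof (cases "k < 2")
    case True
    then show ?thesis using that by (auto simp: less_2_cases_iff)
  next
    case False
    then have "k = (k - 2) + 2" by simp
    then show ?thesis using that by blast
  qed
  then show ?case
  proof cases
    case 1
    then show ?thesis by (intro exI[of _ 1]) auto
  next
    case 2
    then show ?thesis by (intro exI[of _ "[:0, 2:]"]) (auto simp: sin_double)
  next
    case 3
    have "n < k" "n + 1 < k" using 3 by simp_all
    from less.IH[OF this(1)] obtain p where
      p: "\<forall>\<theta>. sin \<theta> \<noteq> 0 \<longrightarrow> poly p (cos \<theta>) = sin (real (n + 1) * \<theta>) / sin \<theta>" ..
    from less.IH[OF \<open>n + 1 < k\<close>] obtain q where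
      "\<forall>\<theta>. sin \<theta> \<noteq> 0 \<longrightarrow> poly q (cos \<theta>) = sin (real (n + 1 + 1) * \<theta>) / sin \<theta>" ..
    moreover have "n + 1 + 1 = n + 2" by simp
    ultimately have q: "\<forall>\<theta>. sin \<theta> \<noteq> 0 \<longrightarrow> poly q (cos \<theta>) = sin (real (n + 2) * \<theta>) / sin \<theta>"
      by (simp only:)
    have "poly ([:0, 2:] * q - p) (cos \<theta>) = sin (real (k + 1) * \<theta>) / sin \<theta>"
      if "sin \<theta> \<noteq> 0" for \<theta>
    proof -
      have e: "real (k + 1) * \<theta> = real (n + 2) * \<theta> + \<theta>"
        "real (n + 1) * \<theta> = real (n + 2) * \<theta> - \<theta>"
        using 3 by (simp_all add: algebra_simps)
      have "sin (real (k + 1) * \<theta>) = 2 * cos \<theta> * sin (real (n + 2) * \<theta>) - sin (real (n + 1) * \<theta>)"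
        unfolding e sin_add sin_diff by simp
      then show ?thesis
        using p[rule_format, OF that] q[rule_format, OF that] by (simp add: diff_divide_distrib)
    qed
    then show ?thesis by (intro exI[of _ "[:0, 2:] * q - p"]) simp
  qed
qed

lemma cheb_U_unique:
  fixes p q :: "real poly"
  assumes "\<forall>\<theta>. sin \<theta> \<noteq> 0 \<longrightarrow> poly p (cos \<theta>) = sin (real (k + 1) * \<theta>) / sin \<theta>"
    and "\<forall>\<theta>. sin \<theta> \<noteq> 0 \<longrightarrow> poly q (cos \<theta>) = sin (real (k + 1) * \<theta>) / sin \<theta>"
  shows "p = q"
proof -
  have "poly p x = poly q x" if "x \<in> {-1<..<1}" for x
  proof -
    have "sin (arccos x) \<noteq> 0"
      using that sin_arccos_nonzero[of x] by simp
    then show ?thesis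
      using assms[THEN spec[of _ "arccos x"]] that by simp
  qed
  then have "{-1<..<1} \<subseteq> {x. poly (p - q) x = 0}" by auto
  moreover have "infinite {-1<..<(1::real)}" by simp
  ultimately have "infinite {x. poly (p - q) x = 0}" using finite_subset by blast
  then show ?thesis using poly_roots_finite[of "p - q"] by auto
qed

lemma poly_cheb_U_cos:
  assumes "sin \<theta> \<noteq> 0"
  shows "poly (cheb_U k) (cos \<theta>) = sin (real (k + 1) * \<theta>) / sin \<theta>"
proof -
  have "\<exists>!p :: real poly. \<forall>\<theta>. sin \<theta> \<noteq> 0 \<longrightarrow> poly p (cos \<theta>) = sin (real (k + 1) * \<theta>) / sin \<theta>"
    by (rule ex_ex1I[OF cheb_U_ex cheb_U_unique])
  from theI'[OF this] show ?thesis using assms unfolding cheb_U_def by blast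
qed

text \<open>
  The two lists of indices are \<open>2m, 2m-2, \<dots>, 2j\<close> and \<open>2m-1, 2m-3, \<dots>, 2m-2j+1\<close>; only \<open>j \<le> m\<close>
  is meaningful.
\<close>

definition X_vec :: "nat \<Rightarrow> nat \<Rightarrow> real \<Rightarrow> real vec" where
  "X_vec m j t = vec_of_list (map (\<lambda>k. poly (cheb_U k) t)
     (map (\<lambda>i. 2 * m - 2 * i) [0..<m - j + 1] @ map (\<lambda>i. 2 * m - 1 - 2 * i) [0..<j]))"

definition Xi_mat :: "nat \<Rightarrow> nat \<Rightarrow> (nat \<Rightarrow> real) \<Rightarrow> real mat" where
  "Xi_mat m j t = mat_of_cols (m + 1) (map (\<lambda>k. X_vec m j (t k)) [0..<m + 1])"

lemma X_vec_carrier: "j \<le> m \<Longrightarrow> X_vec m j t \<in> carrier_vec (m + 1)"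
  by (rule carrier_vecI) (simp only: X_vec_def dim_vec_of_list length_map length_append length_upt)

lemma Xi_mat_carrier: "Xi_mat m j t \<in> carrier_mat (m + 1) (m + 1)"
  unfolding Xi_mat_def by (rule carrier_matI) simp_all

definition phi :: "nat \<Rightarrow> nat \<Rightarrow> real" where
  "phi m j = 2 * real j * pi / (2 * real m + 1)"

end

theory Submission
  imports Defs "Jordan_Normal_Form.Determinant"
begin

text \<open>
  With \<open>z = x + \<i>y\<close>, the Radon projection of \<open>z^a * cnj z^b\<close> in direction \<open>\<theta>\<close> at \<open>t\<close> is
  \<open>exp (\<i>(a - b)\<theta>) * sqrt (1 - t\<^sup>2) * g t\<close>, where \<open>g\<close> has degree exactly \<open>a + b\<close> and lies in the span of
  the \<open>U\<^sub>k\<close> with \<open>\<bar>a - b\<bar> \<le> k \<le> a + b\<close> and \<open>k\<close> of the parity of \<open>a + b\<close>. A discrete Fourier transform over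
  the \<open>N = 2m + 1\<close> directions separates the pairs \<open>(a, b)\<close> by the residue of \<open>a - b\<close> modulo \<open>N\<close>. The
  indices \<open>k\<close> occurring in one residue class never satisfy \<open>k + l = 2m - 1\<close>, and this makes the \<open>U\<^sub>k\<close>
  linearly independent on the nodes, because there the only coincidences are
  \<open>U\<^sub>k = - U\<^sub>l\<close> for \<open>k + l = 2m - 1\<close>. The same independence yields the nonsingularity of the matrices.
\<close>

section \<open>Discrete Fourier analysis on the nodes\<close>

text \<open>A geometric sum of the \<open>N\<close>-th root of unity \<open>z\<close>: it is
  \<open>(z ^ N - 1) / (z - 1) = 0\<close> unless \<open>z = 1\<close>, and \<open>z = 1\<close>
  means that \<open>N\<close> divides \<open>r\<close>.\<close>

lemma sum_cis_roots:
  fixes N :: nat and r :: int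
  assumes "N > 0"
  shows "(\<Sum>j<N. cis (2 * pi * of_int r * real j / real N)) = (if int N dvd r then of_nat N else 0)"
proof -
  define z where "z = cis (2 * pi * of_int r / real N)"
  have pow: "cis (2 * pi * of_int r * real j / real N) = z ^ j" for j
    unfolding z_def Complex.DeMoivre by (simp add: mult_ac)
  have zN: "z ^ N = 1"
    using assms pow[of N, symmetric] by (simp add: cis_multiple_2pi)
  show ?thesis
  proof (cases "int N dvd r")
    case True
    then obtain k where "r = int N * k" by (elim dvdE)
    then have "2 * pi * of_int r / real N = 2 * pi * of_int k" using assms by simp
    then have "z = 1" unfolding z_def by (simp only: cis_multiple_2pi Ints_of_int)
    then show ?thesis using True by (simp add: pow)
  next
    case False
    have "z \<noteq> 1"
    proof
      assume "z = 1"
      then have "Re z = 1" by simp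
      then obtain n :: int where "2 * pi * of_int r / real N = of_int n * 2 * pi"
        by (auto simp: z_def cos_one_2pi_int)
      then have "real_of_int r = of_int (int N * n)"
        using assms by (simp add: field_simps)
      then have "r = int N * n" by (simp only: of_int_eq_iff)
      then show False using False by simp
    qed
    moreover have "(z - 1) * (\<Sum>j<N. z ^ j) = z ^ N - 1"
      by (rule power_diff_1_eq[symmetric])
    ultimately show ?thesis using zN False by (simp add: pow)
  qed
qed

lemma dvd_imp_eq_0_int:
  fixes r :: int
  assumes "int N dvd r" "\<bar>r\<bar> < int N"
  shows "r = 0"
  using assms zdvd_imp_le[of "int N" "\<bar>r\<bar>"] by fastforce

text \<open>Multiplying the \<open>j\<close>-th equation by the character of \<open>- \<rho>\<close>
  and summing over \<open>j\<close> annihilates every frequency not congruent to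
  \<open>\<rho>\<close>. It is used twice: with \<open>j\<close> numbering the nodes, and with
  \<open>j\<close> numbering the directions.\<close>

lemma discrete_fourier_inversion:
  fixes N :: nat and h :: "'s \<Rightarrow> complex" and \<nu> :: "'s \<Rightarrow> int" and \<rho> :: int
  assumes "N > 0" "finite S"
    and zero: "\<And>j. j < N \<Longrightarrow> (\<Sum>s\<in>S. h s * cis (2 * pi * of_int (\<nu> s) * real j / real N)) = 0"
  shows "(\<Sum>s\<in>{s\<in>S. int N dvd \<nu> s - \<rho>}. h s) = 0"
proof -
  define e where "e r j = cis (2 * pi * of_int r * real j / real N)" for r :: int and j :: nat
  have e: "e (\<nu> s - \<rho>) j = e (\<nu> s) j * e (- \<rho>) j" for s j
    unfolding e_def cis_mult by (simp add: algebra_simps diff_divide_distrib add_divide_distrib)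
  have "0 = (\<Sum>j<N. (\<Sum>s\<in>S. h s * e (\<nu> s) j) * e (- \<rho>) j)"
    using zero by (simp add: e_def)
  also have "\<dots> = (\<Sum>j<N. \<Sum>s\<in>S. h s * e (\<nu> s - \<rho>) j)"
    by (simp only: sum_distrib_right e mult.assoc)
  also have "\<dots> = (\<Sum>s\<in>S. h s * (\<Sum>j<N. e (\<nu> s - \<rho>) j))"
    by (subst sum.swap) (simp add: sum_distrib_left)
  also have "\<dots> = (\<Sum>s\<in>S. if int N dvd \<nu> s - \<rho> then of_nat N * h s else 0)"
    unfolding e_def sum_cis_roots[OF \<open>N > 0\<close>] by (intro sum.cong) auto
  also have "\<dots> = of_nat N * (\<Sum>s\<in>{s\<in>S. int N dvd \<nu> s - \<rho>}. h s)"
    using \<open>finite S\<close> by (simp add: sum.If_cases sum_distrib_left Int_def)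
  finally show ?thesis using \<open>N > 0\<close> by simp
qed

section \<open>Chebyshev polynomials of the second kind at the nodes\<close>

lemma sin_node_pos:
  assumes "j \<in> {1..m}"
  shows "sin (2 * real j * pi / (2 * real m + 1)) > 0"
proof (rule sin_gt_zero)
  show "0 < 2 * real j * pi / (2 * real m + 1)" using assms by simp
  have "2 * real j * pi < pi * (2 * real m + 1)"
    using assms by (subst mult.commute, subst mult_less_cancel_left_pos) auto
  then show "2 * real j * pi / (2 * real m + 1) < pi" by (simp add: divide_less_eq add_pos_nonneg)
qed

text \<open>An angle with positive sine serves two purposes: the trigonometric formula for
  \<open>cheb_U\<close> applies, and the half chord length is \<open>sin \<phi>\<close>
  itself.\<close>

lemma node_eq_cos:
  assumes "t 0 \<in> {-1<..<1}"
    and "\<And>j. j \<in> {1..m} \<Longrightarrow> t j = cos (2 * real j * pi / (2 * real m + 1))"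
    and "l \<le> m"
  shows "\<exists>\<phi>. t l = cos \<phi> \<and> sin \<phi> > 0"
proof (cases "l = 0")
  case True
  then show ?thesis
    using assms(1) by (intro exI[of _ "arccos (t l)"]) (auto simp: sin_arccos abs_square_less_1)
next
  case False
  then show ?thesis using assms(2)[of l] sin_node_pos[of l m] assms(3) by auto
qed

text \<open>
  At the nodes \<open>t j\<close> with \<open>j \<ge> 1\<close> the combination becomes a sine sum in the frequencies \<open>k + 1\<close>, and
  the second hypothesis on \<open>E\<close> says that no two of these are opposite modulo \<open>2m + 1\<close>. Only
  \<open>k = 2m\<close> is invisible there; it is detected by \<open>t 0\<close>.
\<close>

lemma cheb_U_independent:
  fixes m :: nat and t c :: "nat \<Rightarrow> real"
  assumes t0: "poly (cheb_U (2 * m)) (t 0) \<noteq> 0"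
    and tj: "\<And>j. j \<in> {1..m} \<Longrightarrow> t j = cos (2 * real j * pi / (2 * real m + 1))"
    and E: "E \<subseteq> {..2 * m}" "\<And>k l. k \<in> E \<Longrightarrow> l \<in> E \<Longrightarrow> Suc (k + l) \<noteq> 2 * m"
    and zero: "\<And>l. l \<le> m \<Longrightarrow> (\<Sum>k\<in>E. c k * poly (cheb_U k) (t l)) = 0"
    and "k \<in> E"
  shows "c k = 0"
proof -
  define N where "N = 2 * m + 1"
  define \<theta> where "\<theta> j = 2 * real j * pi / real N" for j
  define f where "f x = (\<Sum>k\<in>E. c k * sin (real (k + 1) * x))" for x
  have N: "real N = 2 * real m + 1" "N > 0" by (simp_all add: N_def)
  have fin: "finite E" using E(1) finite_subset by blast
  have f1: "f (\<theta> j) = 0" if "j \<in> {1..m}" for j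
  proof -
    have s: "sin (\<theta> j) \<noteq> 0"
      using sin_node_pos[OF that] by (simp add: \<theta>_def N)
    have "t j = cos (\<theta> j)" using tj[OF that] by (simp add: \<theta>_def N)
    then have "(\<Sum>k\<in>E. c k * (sin (real (k + 1) * \<theta> j) / sin (\<theta> j))) = 0"
      using zero[of j] that s by (simp add: poly_cheb_U_cos)
    then have "f (\<theta> j) / sin (\<theta> j) = 0" by (simp add: f_def sum_divide_distrib)
    then show ?thesis using s by simp
  qed
  \<comment> \<open>Fourier inversion needs all residues \<open>j\<close>. Since \<open>f\<close> is
    odd and has period \<open>2 * pi\<close>, and
    \<open>\<theta> j = 2 * pi - \<theta> (N - j)\<close>, the zeros for \<open>1..m\<close> give
    those for \<open>m + 1..2 * m\<close>.\<close>
  have f: "f (\<theta> j) = 0" if "j < N" for j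
  proof -
    have "j = 0 \<or> j \<in> {1..m} \<or> N - j \<in> {1..m}" using that by (auto simp: N_def)
    then consider "j = 0" | "j \<in> {1..m}" | "N - j \<in> {1..m}" by blast
    then show ?thesis
    proof cases
      case 1
      then show ?thesis by (simp add: f_def \<theta>_def)
    next
      case 3
      have \<theta>: "\<theta> j = 2 * pi - \<theta> (N - j)"
        using that N(2) by (simp add: \<theta>_def of_nat_diff field_simps)
      have "sin (real (k + 1) * (2 * pi - x)) = - sin (real (k + 1) * x)" for k x
      proof -
        have "real (k + 1) * (2 * pi - x) = - (real (k + 1) * x) + real (k + 1) * (2 * pi)"
          by (simp only: algebra_simps)
        also have "sin \<dots> = sin (- (real (k + 1) * x))"
          using sin.plus_of_nat[of "- (real (k + 1) * x)" "k + 1"] by simp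
        finally show ?thesis by simp
      qed
      then have "f (\<theta> j) = - f (\<theta> (N - j))" by (simp only: \<theta> f_def sum_negf mult_minus_right)
      then show ?thesis using f1[OF 3] by simp
    qed (rule f1)
  qed
  have small: "c k = 0" if "k \<in> E" "k \<noteq> 2 * m" for k
  proof -
    \<comment> \<open>Each sine is split into two exponentials; the Boolean selects the sign of the
      frequency. The common factor \<open>1 / (2 * \<i>)\<close> is dropped.\<close>
    define h where "h = (\<lambda>(l, b). if b then of_real (c l) else - complex_of_real (c l))"
    define \<nu> where "\<nu> = (\<lambda>(l :: nat, b). if b then int (l + 1) else - int (l + 1))"
    have "(\<Sum>s\<in>E \<times> UNIV. h s * cis (2 * pi * of_int (\<nu> s) * real j / real N)) = 0" if "j < N" for j
    proof -
      have 1: "of_real (c l) * cis (2 * pi * real (l + 1) * real j / real N)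
          - of_real (c l) * cis (- (2 * pi * real (l + 1) * real j / real N))
          = 2 * \<i> * of_real (c l * sin (real (l + 1) * \<theta> j))" for l
      proof -
        have "2 * pi * real (l + 1) * real j / real N = real (l + 1) * \<theta> j" by (simp add: \<theta>_def)
        then show ?thesis by (simp only:) (simp add: complex_eq_iff)
      qed
      have "(\<Sum>s\<in>E \<times> UNIV. h s * cis (2 * pi * of_int (\<nu> s) * real j / real N))
          = (\<Sum>l\<in>E. of_real (c l) * cis (2 * pi * real (l + 1) * real j / real N)
            - of_real (c l) * cis (- (2 * pi * real (l + 1) * real j / real N)))"
        unfolding sum.cartesian_product[symmetric] UNIV_bool sum.cartesian_product'
        by (intro sum.cong refl) (simp add: h_def \<nu>_def del: of_nat_add of_nat_Suc)
      also have "\<dots> = 2 * \<i> * of_real (f (\<theta> j))"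
        unfolding 1 f_def of_real_sum sum_distrib_left ..
      finally show ?thesis using f[OF that] by simp
    qed
    then have "(\<Sum>s\<in>{s \<in> E \<times> UNIV. int N dvd \<nu> s - int (k + 1)}. h s) = 0"
      using fin N(2) by (intro discrete_fourier_inversion) auto
    \<comment> \<open>A negative frequency in the class of \<open>k + 1\<close> would make
      \<open>l + k + 2\<close> a multiple of \<open>N\<close>. As \<open>k < 2 * m\<close>, that
      multiple is \<open>N\<close> itself, so \<open>Suc (k + l) = 2 * m\<close>, which the
      hypothesis on \<open>E\<close> excludes.\<close>
    moreover have "{s \<in> E \<times> UNIV. int N dvd \<nu> s - int (k + 1)} = {(k, True)}"
    proof (intro equalityI subsetI)
      fix s assume "s \<in> {s \<in> E \<times> UNIV. int N dvd \<nu> s - int (k + 1)}"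
      then obtain l b where s: "s = (l, b)" "l \<in> E" "int N dvd \<nu> (l, b) - int (k + 1)" by auto
      have l: "l \<le> 2 * m" and k: "k < 2 * m" using E(1) s(2) that by auto
      show "s \<in> {(k, True)}"
      proof (cases b)
        case True
        then have "int N dvd int l - int k" using s(3) by (simp add: \<nu>_def)
        then have "int l - int k = 0"
          using l k by (intro dvd_imp_eq_0_int[of N]) (auto simp: N_def)
        then show ?thesis using s True by simp
      next
        case False
        then have "int N dvd - (int l + int k + 2)" using s(3) by (simp add: \<nu>_def algebra_simps)
        then have "N dvd l + k + 2" by (metis dvd_minus_iff int_dvd_int_iff of_nat_add of_nat_numeral)
        then obtain q where q: "l + k + 2 = N * q" by (elim dvdE)
        have "q < 2"
        proof (rule ccontr)
          assume "\<not> q < 2"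
          then have "N * 2 \<le> N * q" by (intro mult_le_mono2) simp
          then show False using q l k by (simp add: N_def)
        qed
        then have "q = 1" using q by (cases q) auto
        then show ?thesis using q E(2)[OF s(2) that(1)] by (simp add: N_def)
      qed
    qed (use that in \<open>auto simp: \<nu>_def\<close>)
    ultimately show ?thesis by (simp add: h_def)
  qed
  show ?thesis
  proof (cases "k = 2 * m")
    case True
    have "(\<Sum>l\<in>E. c l * poly (cheb_U l) (t 0)) = c k * poly (cheb_U k) (t 0)"
      using fin \<open>k \<in> E\<close> small True by (subst sum.remove[of _ k]) (auto intro!: sum.neutral)
    then show ?thesis using zero[of 0] t0 True by simp
  qed (use small \<open>k \<in> E\<close> in auto)
qed

section \<open>Nonsingularity of the matrices\<close>

text \<open>A linear relation between the rows is a combination of the \<open>cheb_U k\<close>, with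
  \<open>k\<close> among the row indices, that vanishes at every node, so
  \<open>cheb_U_independent\<close> applies.\<close>

lemma invertible_Xi_mat:
  fixes m j :: nat and t :: "nat \<Rightarrow> real"
  assumes "poly (cheb_U (2 * m)) (t 0) \<noteq> 0"
    and "\<And>j. j \<in> {1..m} \<Longrightarrow> t j = cos (2 * real j * pi / (2 * real m + 1))"
    and "j \<le> m"
  shows "invertible_mat (Xi_mat m j t)"
proof -
  define A where "A = Xi_mat m j t"
  define ks where "ks = map (\<lambda>i. 2 * m - 2 * i) [0..<m - j + 1] @ map (\<lambda>i. 2 * m - 1 - 2 * i) [0..<j]"
  have A: "A \<in> carrier_mat (m + 1) (m + 1)" unfolding A_def by (rule Xi_mat_carrier)
  have len: "length ks = m + 1" using assms(3) by (simp add: ks_def)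
  have entry: "A $$ (r, l) = poly (cheb_U (ks ! r)) (t l)" if "r < m + 1" "l < m + 1" for r l
  proof -
    have X: "X_vec m j x = vec_of_list (map (\<lambda>k. poly (cheb_U k) x) ks)" for x
      by (simp only: X_vec_def ks_def)
    show ?thesis
      using that len unfolding A_def Xi_mat_def X
      by (simp add: mat_of_cols_def vec_of_list_index del: upt_Suc)
  qed
  have odd: "odd (2 * m - 1 - 2 * i)" if "i < j" for i
  proof -
    have "2 * m - 1 - 2 * i = 2 * (m - 1 - i) + 1" using that assms(3) by simp
    then show ?thesis by simp
  qed
  have "inj_on (\<lambda>i. 2 * m - 2 * i) {0..<m - j + 1}" "inj_on (\<lambda>i. 2 * m - 1 - 2 * i) {0..<j}"
    using assms(3) by (auto simp: inj_on_def)
  moreover have "2 * m - 2 * i \<noteq> 2 * m - 1 - 2 * i'" if "i' < j" for i i'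
    using odd[OF that] by (metis dvd_triv_left right_diff_distrib')
  ultimately have dist: "distinct ks"
    unfolding ks_def by (auto simp: distinct_map simp del: upt_Suc)
  have ks: "set ks \<subseteq> {..2 * m}" by (auto simp: ks_def)
  \<comment> \<open>An even index is at least \<open>2 * j\<close> and an odd one at least
    \<open>2 * m + 1 - 2 * j\<close>. Two indices of opposite parity thus add up to at least
    \<open>2 * m + 1\<close>, never to \<open>2 * m - 1\<close>.\<close>
  have ks_cases: "(even k \<and> 2 * j \<le> k) \<or> (odd k \<and> 2 * m + 1 \<le> k + 2 * j)" if "k \<in> set ks" for k
  proof -
    have "(\<exists>i. i < m - j + 1 \<and> k = 2 * m - 2 * i) \<or> (\<exists>i. i < j \<and> k = 2 * m - 1 - 2 * i)"
      using that by (auto simp: ks_def simp del: upt_Suc)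
    then consider i where "i < m - j + 1" "k = 2 * m - 2 * i" | i where "i < j" "k = 2 * m - 1 - 2 * i"
      by blast
    then show ?thesis
    proof cases
      case (1 i)
      then show ?thesis using assms(3) by simp
    next
      case (2 i)
      then show ?thesis using assms(3) odd[of i] by simp
    qed
  qed
  have opp: "Suc (k + l) \<noteq> 2 * m" if "k \<in> set ks" "l \<in> set ks" for k l
  proof
    assume *: "Suc (k + l) = 2 * m"
    then have "odd (k + l)" by (metis dvd_triv_left even_Suc)
    then show False using ks_cases[OF that(1)] ks_cases[OF that(2)] * by auto
  qed
  have "Determinant.det (transpose_mat A) \<noteq> 0"
  proof
    assume "Determinant.det (transpose_mat A) = 0"
    then obtain v where v: "v \<in> carrier_vec (m + 1)" "v \<noteq> 0\<^sub>v (m + 1)"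
        "transpose_mat A *\<^sub>v v = 0\<^sub>v (m + 1)"
      using det_0_iff_vec_prod_zero[of "transpose_mat A" "m + 1"] A by auto
    have bij: "bij_betw (nth ks) {..<m + 1} (set ks)"
      using bij_betw_nth[OF dist refl refl] by (simp only: len)
    \<comment> \<open>The kernel vector is indexed by row position; \<open>c\<close> re-indexes it
      by the Chebyshev index standing in that row.\<close>
    define c where "c k = vec_index v (inv_into {..<m + 1} (nth ks) k)" for k
    have c: "c (ks ! r) = vec_index v r" if "r < m + 1" for r
      using that inv_into_f_f[OF bij_betw_imp_inj_on[OF bij], of r] by (simp add: c_def)
    have "(\<Sum>k\<in>set ks. c k * poly (cheb_U k) (t l)) = 0" if "l \<le> m" for l
    proof -
      have "(\<Sum>k\<in>set ks. c k * poly (cheb_U k) (t l))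
          = (\<Sum>r<m + 1. c (ks ! r) * poly (cheb_U (ks ! r)) (t l))"
        by (rule sum.reindex_bij_betw[OF bij, symmetric])
      also have "\<dots> = (\<Sum>r<m + 1. A $$ (r, l) * vec_index v r)"
        using that by (intro sum.cong refl) (simp add: c entry)
      also have "\<dots> = vec_index (transpose_mat A *\<^sub>v v) l"
        using that A v(1) by (simp add: scalar_prod_def lessThan_atLeast0)
      also have "\<dots> = 0" using that by (simp add: v(3))
      finally show ?thesis .
    qed
    from cheb_U_independent[OF assms(1,2) ks opp this] have "c k = 0" if "k \<in> set ks" for k
      using that by blast
    then have "vec_index v r = 0" if "r < m + 1" for r
      using c[OF that] that len by (metis nth_mem)
    then have "v = 0\<^sub>v (m + 1)" using v(1) by (intro eq_vecI) auto
    then show False using v(2) by simp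
  qed
  then have "Determinant.det A \<noteq> 0" using det_transpose[OF A] by simp
  from det_non_zero_imp_unit[OF A this, of "()"] obtain B
    where "B \<in> carrier_mat (m + 1) (m + 1)" "B * A = 1\<^sub>m (m + 1)" "A * B = 1\<^sub>m (m + 1)"
    by (auto simp: Units_def ring_mat_def)
  then have "invertible_mat A"
    using A unfolding invertible_mat_def inverts_mat_def square_mat.simps by auto
  then show ?thesis by (simp only: A_def)
qed

section \<open>Spans of Chebyshev polynomials\<close>

lemma cheb_U_eqI:
  assumes "\<And>\<theta>. sin \<theta> \<noteq> 0 \<Longrightarrow> poly p (cos \<theta>) = sin (real (k + 1) * \<theta>) / sin \<theta>"
  shows "cheb_U k = p"
  by (rule cheb_U_unique) (use assms poly_cheb_U_cos in auto)

lemma cheb_U_0: "cheb_U 0 = 1"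
  by (rule cheb_U_eqI) auto

lemma cheb_U_1: "cheb_U (Suc 0) = [:0, 2:]"
  by (rule cheb_U_eqI) (auto simp: sin_double)

lemma cheb_U_Suc_Suc: "cheb_U (Suc (Suc k)) = [:0, 2:] * cheb_U (Suc k) - cheb_U k"
proof (rule cheb_U_eqI)
  fix \<theta> :: real
  assume s: "sin \<theta> \<noteq> 0"
  have e: "real (Suc (Suc k) + 1) * \<theta> = real (Suc k + 1) * \<theta> + \<theta>"
    "real (k + 1) * \<theta> = real (Suc k + 1) * \<theta> - \<theta>"
    by (simp_all add: algebra_simps)
  have "sin (real (Suc (Suc k) + 1) * \<theta>)
      = 2 * cos \<theta> * sin (real (Suc k + 1) * \<theta>) - sin (real (k + 1) * \<theta>)"
    unfolding e sin_add sin_diff by simp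
  then show "poly ([:0, 2:] * cheb_U (Suc k) - cheb_U k) (cos \<theta>)
      = sin (real (Suc (Suc k) + 1) * \<theta>) / sin \<theta>"
    using poly_cheb_U_cos[OF s, of "Suc k"] poly_cheb_U_cos[OF s, of k]
    by (simp add: diff_divide_distrib)
qed

lemma coeff_2X_mult: "coeff ([:0, 2:] * p) (Suc k) = 2 * coeff (p :: real poly) k"
  by simp

lemma degree_2X_mult_le: "degree (p :: real poly) \<le> n \<Longrightarrow> degree ([:0, 2:] * p) \<le> Suc n"
  by (rule order.trans[OF degree_mult_le]) simp

lemma degree_cheb_U_le: "degree (cheb_U k) \<le> k"
proof (induction k rule: induct_nat_012)
  case (ge2 n)
  then show ?case
    unfolding cheb_U_Suc_Suc by (intro degree_diff_le degree_2X_mult_le) auto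
qed (auto simp: cheb_U_0 cheb_U_1)

lemma coeff_cheb_U: "coeff (cheb_U k) k = 2 ^ k"
proof (induction k rule: induct_nat_012)
  case (ge2 n)
  have "coeff (cheb_U n) (Suc (Suc n)) = 0"
    using degree_cheb_U_le[of n] by (intro coeff_eq_0) auto
  then show ?case
    using ge2 by (simp only: cheb_U_Suc_Suc coeff_diff coeff_2X_mult) simp
qed (auto simp: cheb_U_0 cheb_U_1)

text \<open>For infinite \<open>K\<close> the sum is zero by convention and only the zero polynomial
  remains; hence the finiteness hypotheses in the lemmas that follow.\<close>

definition U_span :: "nat set \<Rightarrow> real poly set" where
  "U_span K = {p. \<exists>c. p = (\<Sum>k\<in>K. Polynomial.smult (c k) (cheb_U k))}"

lemma U_span_add: "p \<in> U_span K \<Longrightarrow> q \<in> U_span K \<Longrightarrow> p + q \<in> U_span K"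
proof -
  assume "p \<in> U_span K" "q \<in> U_span K"
  then obtain c d where "p = (\<Sum>k\<in>K. Polynomial.smult (c k) (cheb_U k))" "q = (\<Sum>k\<in>K. Polynomial.smult (d k) (cheb_U k))"
    unfolding U_span_def by blast
  then have "p + q = (\<Sum>k\<in>K. Polynomial.smult (c k + d k) (cheb_U k))"
    by (simp add: smult_add_left sum.distrib)
  then show ?thesis unfolding U_span_def mem_Collect_eq by (rule exI[of _ "\<lambda>k. c k + d k"])
qed

lemma smult_sum_right:
  "Polynomial.smult a (\<Sum>i\<in>I. f i) = (\<Sum>i\<in>I. Polynomial.smult a (f i))"
  by (induction I rule: infinite_finite_induct) (auto simp: smult_add_right)

lemma U_span_smult: "p \<in> U_span K \<Longrightarrow> Polynomial.smult a p \<in> U_span K"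
proof -
  assume "p \<in> U_span K"
  then obtain c where "p = (\<Sum>k\<in>K. Polynomial.smult (c k) (cheb_U k))"
    unfolding U_span_def by blast
  then have "Polynomial.smult a p = (\<Sum>k\<in>K. Polynomial.smult (a * c k) (cheb_U k))"
    by (simp add: smult_sum_right)
  then show ?thesis unfolding U_span_def mem_Collect_eq by (rule exI[of _ "\<lambda>k. a * c k"])
qed

lemma U_span_0: "0 \<in> U_span K"
  unfolding U_span_def mem_Collect_eq by (rule exI[of _ "\<lambda>_. 0"]) simp

lemma U_span_diff: "p \<in> U_span K \<Longrightarrow> q \<in> U_span K \<Longrightarrow> p - q \<in> U_span K"
  using U_span_add[of p K "Polynomial.smult (-1) q"] U_span_smult[of q K "-1"] by simp

lemma U_span_sum: "(\<And>i. i \<in> I \<Longrightarrow> f i \<in> U_span K) \<Longrightarrow> (\<Sum>i\<in>I. f i) \<in> U_span K"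
  by (induction I rule: infinite_finite_induct) (auto intro: U_span_0 U_span_add)

lemma U_span_mono:
  assumes "K \<subseteq> L" "finite L" "p \<in> U_span K"
  shows "p \<in> U_span L"
proof -
  obtain c where "p = (\<Sum>k\<in>K. Polynomial.smult (c k) (cheb_U k))"
    using assms unfolding U_span_def by blast
  also have "\<dots> = (\<Sum>k\<in>K. Polynomial.smult (if k \<in> K then c k else 0) (cheb_U k))"
    by (intro sum.cong) auto
  also have "\<dots> = (\<Sum>k\<in>L. Polynomial.smult (if k \<in> K then c k else 0) (cheb_U k))"
    using assms by (intro sum.mono_neutral_left) auto
  finally show ?thesis
    unfolding U_span_def mem_Collect_eq by (rule exI[of _ "\<lambda>k. if k \<in> K then c k else 0"])
qed

lemma cheb_U_in_U_span:
  assumes "finite K" "k \<in> K"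
  shows "cheb_U k \<in> U_span K"
proof -
  have "cheb_U k = (\<Sum>l\<in>K. Polynomial.smult (if l = k then 1 else 0) (cheb_U l))"
    using assms by (simp add: if_distrib[of "\<lambda>c. Polynomial.smult c _"] sum.delta cong: if_cong)
  then show ?thesis
    unfolding U_span_def mem_Collect_eq by (rule exI[of _ "\<lambda>l. if l = k then 1 else 0"])
qed

text \<open>The recurrence reads \<open>2 x U_k = U_(k+1) + U_(k-1)\<close>, where the last term is
  absent for \<open>k = 0\<close>. So \<open>L\<close> has to contain the neighbours of all indices
  in \<open>K\<close>.\<close>

lemma U_span_2X_mult:
  assumes "p \<in> U_span K" "finite L"
    and "\<And>k. k \<in> K \<Longrightarrow> Suc k \<in> L" "\<And>k. Suc k \<in> K \<Longrightarrow> k \<in> L"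
  shows "[:0, 2:] * p \<in> U_span L"
proof -
  have U: "[:0, 2:] * cheb_U k \<in> U_span L" if "k \<in> K" for k
  proof (cases k)
    case 0
    then have "[:0, 2:] * cheb_U k = cheb_U (Suc k)" by (simp add: cheb_U_0 cheb_U_1)
    then show ?thesis using assms that by (auto intro: cheb_U_in_U_span)
  next
    case (Suc l)
    have "[:0, 2:] * cheb_U k = cheb_U (Suc k) + cheb_U l"
      using cheb_U_Suc_Suc[of l] Suc by (simp del: mult_pCons_left)
    then show ?thesis
      using assms that Suc by (auto intro!: U_span_add cheb_U_in_U_span simp del: mult_pCons_left)
  qed
  obtain c where "p = (\<Sum>k\<in>K. Polynomial.smult (c k) (cheb_U k))"
    using assms unfolding U_span_def by blast
  then have "[:0, 2:] * p = (\<Sum>k\<in>K. Polynomial.smult (c k) ([:0, 2:] * cheb_U k))"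
    by (simp only: sum_distrib_left mult_smult_right)
  then show ?thesis using U by (simp only: U_span_sum U_span_smult)
qed

text \<open>The values at \<open>m + 1\<close> nodes determine a polynomial of degree up to
  \<open>2 * m\<close> here, because the admissible index sets \<open>E\<close> contain no pair with
  sum \<open>2 * m - 1\<close>.\<close>

lemma U_span_eq_0:
  assumes "poly (cheb_U (2 * m)) (t 0) \<noteq> 0"
    and "\<And>j. j \<in> {1..m} \<Longrightarrow> t j = cos (2 * real j * pi / (2 * real m + 1))"
    and "E \<subseteq> {..2 * m}" "\<And>k l. k \<in> E \<Longrightarrow> l \<in> E \<Longrightarrow> Suc (k + l) \<noteq> 2 * m"
    and "p \<in> U_span E" and zero: "\<And>l. l \<le> m \<Longrightarrow> poly p (t l) = 0"
  shows "p = 0"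
proof -
  obtain c where c: "p = (\<Sum>k\<in>E. Polynomial.smult (c k) (cheb_U k))"
    using assms(5) unfolding U_span_def by blast
  have "c k = 0" if "k \<in> E" for k
  proof (rule cheb_U_independent[OF assms(1-4) _ that, where c = c])
    fix l assume "l \<le> m"
    then show "(\<Sum>k\<in>E. c k * poly (cheb_U k) (t l)) = 0"
      using zero[of l] unfolding c by (simp add: poly_sum)
  qed
  then show ?thesis by (simp add: c)
qed

section \<open>Radon projections of the monomials in z and its conjugate\<close>

text \<open>Up to the factor \<open>sin \<phi>\<close>, this is the integral of
  \<open>z ^ a * cnj z ^ b\<close> along the chord \<open>Re z = cos \<phi>\<close> of the unit
  disk, as a polynomial in \<open>cos \<phi>\<close>. The recursion reflects
  \<open>cnj z = 2 * cos \<phi> - z\<close> on that chord.\<close>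

fun ridge_poly :: "nat \<Rightarrow> nat \<Rightarrow> real poly" where
  "ridge_poly a 0 = Polynomial.smult (2 / real (a + 1)) (cheb_U a)"
| "ridge_poly a (Suc b) = [:0, 2:] * ridge_poly a b - ridge_poly (Suc a) b"

text \<open>Each recursion step widens the index range by one at both ends and flips the parity. The
  lower bound \<open>a - b\<close>, written without subtraction, is what later bounds
  \<open>\<bar>a - b\<bar>\<close> by the occurring indices.\<close>

lemma ridge_poly_in_U_span:
  "b \<le> a \<Longrightarrow> ridge_poly a b \<in> U_span {k. a \<le> k + b \<and> k \<le> a + b \<and> even (k + a + b)}"
proof (induction b arbitrary: a)
  case 0
  have "{k. a \<le> k + 0 \<and> k \<le> a + 0 \<and> even (k + a + 0)} = {a}" by auto
  then show ?case by (simp add: U_span_smult cheb_U_in_U_span)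
next
  case (Suc b)
  define L where "L = {k. a \<le> k + Suc b \<and> k \<le> a + Suc b \<and> even (k + a + Suc b)}"
  have L: "finite L" by (rule finite_subset[of _ "{..a + Suc b}"]) (auto simp: L_def)
  have "[:0, 2:] * ridge_poly a b \<in> U_span L"
  proof (rule U_span_2X_mult[OF Suc.IH L])
    show "b \<le> a" using Suc.prems by simp
  qed (use Suc.prems in \<open>auto simp: L_def\<close>)
  moreover have "ridge_poly (Suc a) b \<in> U_span L"
    by (rule U_span_mono[OF _ L Suc.IH]) (use Suc.prems in \<open>auto simp: L_def\<close>)
  ultimately show ?case
    unfolding L_def[symmetric] ridge_poly.simps by (rule U_span_diff)
qed

lemma degree_ridge_poly_le: "degree (ridge_poly a b) \<le> a + b"
proof (induction b arbitrary: a)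
  case 0
  then show ?case using degree_cheb_U_le[of a] degree_smult_le[of "2 / real (a + 1)" "cheb_U a"]
    by simp
next
  case (Suc b)
  show ?case
    unfolding ridge_poly.simps using Suc.IH[of a] Suc.IH[of "Suc a"]
    by (intro degree_diff_le) (use degree_2X_mult_le in fastforce)+
qed

text \<open>The value is \<open>2 ^ (a + b + 1) * B(a + 1, b + 1)\<close> with Euler's Beta
  function, and the recursion becomes \<open>B(x, y) = B(x + 1, y) + B(x, y + 1)\<close>. Being
  nonzero, it shows that the degree is exactly \<open>a + b\<close>.\<close>

lemma coeff_ridge_poly:
  "coeff (ridge_poly a b) (a + b) = 2 ^ (a + b + 1) * fact a * fact b / fact (a + b + 1)"
proof (induction b arbitrary: a)
  case 0
  then show ?case
    by (simp add: coeff_cheb_U divide_simps del: fact_Suc of_nat_Suc) (simp add: algebra_simps)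
next
  case (Suc b)
  have "coeff (ridge_poly a (Suc b)) (a + Suc b)
      = 2 * (2 ^ (a + b + 1) * fact a * fact b / fact (a + b + 1))
        - 2 ^ (Suc a + b + 1) * fact (Suc a) * fact b / fact (Suc a + b + 1)"
    using Suc.IH[of a] Suc.IH[of "Suc a"]
    by (simp only: ridge_poly.simps coeff_diff add_Suc_right coeff_2X_mult) simp
  also have "\<dots> = 2 ^ (a + Suc b + 1) * fact a * fact (Suc b) / fact (a + Suc b + 1)"
  proof -
    have "fact (a + b + 1 + 1) = (real a + real b + 2) * (fact (a + b + 1) :: real)"
      by (simp add: algebra_simps)
    then show ?thesis
      by (simp add: divide_simps del: fact_Suc) (simp add: algebra_simps)
  qed
  finally show ?case .
qed

lemma has_integral_ridge_poly:
  fixes \<phi> :: real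
  assumes "sin \<phi> > 0"
  shows "((\<lambda>s. Complex (cos \<phi>) s ^ a * cnj (Complex (cos \<phi>) s) ^ b) has_integral
      of_real (sin \<phi> * poly (ridge_poly a b) (cos \<phi>))) {- sin \<phi>..sin \<phi>}"
proof (induction b arbitrary: a)
  case 0
  \<comment> \<open>An antiderivative of \<open>z ^ a\<close> in \<open>s\<close>: along the chord
    \<open>z = cos \<phi> + \<i> s\<close> has derivative \<open>\<i>\<close>.\<close>
  define F where "F s = Complex (cos \<phi>) s ^ (a + 1) / (\<i> * of_nat (a + 1))" for s
  have "((\<lambda>s. Complex (cos \<phi>) s ^ a) has_integral F (sin \<phi>) - F (- sin \<phi>)) {- sin \<phi>..sin \<phi>}"
  proof (rule fundamental_theorem_of_calculus)
    fix s :: real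
    have "((\<lambda>w. (of_real (cos \<phi>) + \<i> * w) ^ (a + 1)) has_field_derivative
        of_nat (a + 1) * \<i> * (of_real (cos \<phi>) + \<i> * of_real s) ^ a) (at (of_real s))"
    proof -
      have "((\<lambda>w. of_real (cos \<phi>) + \<i> * w) has_field_derivative \<i>) (at (of_real s))"
        by (auto intro!: derivative_eq_intros)
      from DERIV_power[OF this, of "a + 1"] show ?thesis
        by (simp only: add_diff_cancel_right' mult_ac One_nat_def[symmetric])
    qed
    from DERIV_cdivide[OF this, of "\<i> * of_nat (a + 1)"]
    have "((\<lambda>w. (of_real (cos \<phi>) + \<i> * w) ^ (a + 1) / (\<i> * of_nat (a + 1)))
        has_field_derivative (of_real (cos \<phi>) + \<i> * of_real s) ^ a) (at (of_real s))"
      by (simp del: of_nat_Suc of_nat_add power_Suc)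
    from has_vector_derivative_real_field[OF this]
    show "(F has_vector_derivative Complex (cos \<phi>) s ^ a) (at s within {- sin \<phi>..sin \<phi>})"
      unfolding F_def Complex_eq .
  qed (use assms in auto)
  moreover have "F (sin \<phi>) - F (- sin \<phi>) = of_real (sin \<phi> * poly (ridge_poly a 0) (cos \<phi>))"
  proof -
    \<comment> \<open>The chord ends on the unit circle, so De Moivre's formula turns the boundary
      terms into the sine in the numerator of \<open>cheb_U a\<close>.\<close>
    have "Complex (cos \<phi>) (sin \<phi>) = cis \<phi>" "Complex (cos \<phi>) (- sin \<phi>) = cis (- \<phi>)"
      by (simp_all add: complex_eq_iff)
    then have "Complex (cos \<phi>) (sin \<phi>) ^ (a + 1) = cis (real (a + 1) * \<phi>)"
      "Complex (cos \<phi>) (- sin \<phi>) ^ (a + 1) = cis (- (real (a + 1) * \<phi>))"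
      by (simp_all only: Complex.DeMoivre mult_minus_right)
    then have "F (sin \<phi>) - F (- sin \<phi>)
        = (cis (real (a + 1) * \<phi>) - cis (- (real (a + 1) * \<phi>))) / (\<i> * of_nat (a + 1))"
      unfolding F_def by (simp only: diff_divide_distrib)
    also have "cis (real (a + 1) * \<phi>) - cis (- (real (a + 1) * \<phi>)) = 2 * \<i> * of_real (sin (real (a + 1) * \<phi>))"
      by (simp add: complex_eq_iff)
    also have "\<dots> / (\<i> * of_nat (a + 1)) = of_real (2 * sin (real (a + 1) * \<phi>) / real (a + 1))"
      by (simp del: of_nat_Suc)
    finally show ?thesis
      using assms by (simp add: poly_cheb_U_cos)
  qed
  ultimately show ?case by simp
next
  case (Suc b)
  define z where "z s = Complex (cos \<phi>) s" for s
  have cnj_z: "cnj (z s) = 2 * of_real (cos \<phi>) - z s" for s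
    by (simp add: z_def complex_eq_iff)
  have "(\<lambda>s. z s ^ a * cnj (z s) ^ Suc b)
      = (\<lambda>s. 2 * of_real (cos \<phi>) * (z s ^ a * cnj (z s) ^ b) - z s ^ Suc a * cnj (z s) ^ b)"
  proof
    fix s
    have "z s ^ a * cnj (z s) ^ Suc b = z s ^ a * cnj (z s) ^ b * cnj (z s)" by simp
    also have "\<dots> = 2 * of_real (cos \<phi>) * (z s ^ a * cnj (z s) ^ b) - z s ^ Suc a * cnj (z s) ^ b"
      by (subst (2) cnj_z) (simp add: algebra_simps)
    finally show "z s ^ a * cnj (z s) ^ Suc b
      = 2 * of_real (cos \<phi>) * (z s ^ a * cnj (z s) ^ b) - z s ^ Suc a * cnj (z s) ^ b" .
  qed
  moreover have "(\<dots> has_integral 2 * of_real (cos \<phi>) * of_real (sin \<phi> * poly (ridge_poly a b) (cos \<phi>))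
      - of_real (sin \<phi> * poly (ridge_poly (Suc a) b) (cos \<phi>))) {- sin \<phi>..sin \<phi>}"
    unfolding z_def by (intro has_integral_diff has_integral_mult_right Suc.IH)
  moreover have "2 * of_real (cos \<phi>) * of_real (sin \<phi> * poly (ridge_poly a b) (cos \<phi>))
      - of_real (sin \<phi> * poly (ridge_poly (Suc a) b) (cos \<phi>))
      = complex_of_real (sin \<phi> * poly (ridge_poly a (Suc b)) (cos \<phi>))"
  proof -
    have "poly (ridge_poly a (Suc b)) (cos \<phi>)
        = 2 * cos \<phi> * poly (ridge_poly a b) (cos \<phi>) - poly (ridge_poly (Suc a) b) (cos \<phi>)"
      by (simp add: mult_ac)
    then show ?thesis by (simp only: of_real_mult of_real_diff of_real_numeral) (simp add: right_diff_distrib mult_ac)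
  qed
  ultimately show ?case unfolding z_def by (simp only:)
qed

text \<open>Exchanging \<open>a\<close> and \<open>b\<close> conjugates the integrand, and the
  integral is real.\<close>

lemma has_integral_ridge_poly_max_min:
  fixes \<phi> :: real
  assumes "sin \<phi> > 0"
  shows "((\<lambda>s. Complex (cos \<phi>) s ^ a * cnj (Complex (cos \<phi>) s) ^ b) has_integral
      of_real (sin \<phi> * poly (ridge_poly (max a b) (min a b)) (cos \<phi>))) {- sin \<phi>..sin \<phi>}"
proof (cases "b \<le> a")
  case True
  then show ?thesis using has_integral_ridge_poly[OF assms, of a b] by (simp add: max_absorb1 min_absorb2)
next
  case False
  then have "max a b = b" "min a b = a" by simp_all
  moreover have "((\<lambda>s. cnj (Complex (cos \<phi>) s ^ b * cnj (Complex (cos \<phi>) s) ^ a)) has_integral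
      cnj (of_real (sin \<phi> * poly (ridge_poly b a) (cos \<phi>)))) {- sin \<phi>..sin \<phi>}"
    using has_integral_ridge_poly[OF assms, of b a] by (simp only: has_integral_cnj[unfolded o_def])
  moreover have "cnj (Complex (cos \<phi>) s ^ b * cnj (Complex (cos \<phi>) s) ^ a)
      = Complex (cos \<phi>) s ^ a * cnj (Complex (cos \<phi>) s) ^ b" for s
    by (simp only: complex_cnj_mult complex_cnj_power complex_cnj_cnj mult.commute)
  ultimately show ?thesis by (simp only: complex_cnj_complex_of_real)
qed

section \<open>Independence within one residue class of \<open>a - b\<close>\<close>

text \<open>Among the terms with nonzero coefficient, the one with the largest
  \<open>\<delta>\<close> is the only one that contributes to the coefficient of that degree, so it
  cannot cancel.\<close>

lemma smult_sum_degree_inj_eq_0: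
  fixes g :: "'s \<Rightarrow> 'a :: idom poly"
  assumes "finite S" "inj_on \<delta> S"
    and deg: "\<And>s. s \<in> S \<Longrightarrow> degree (g s) \<le> \<delta> s" "\<And>s. s \<in> S \<Longrightarrow> coeff (g s) (\<delta> s) \<noteq> 0"
    and zero: "(\<Sum>s\<in>S. Polynomial.smult (e s) (g s)) = 0"
    and "s \<in> S"
  shows "e s = 0"
proof (rule ccontr)
  assume "e s \<noteq> 0"
  define A where "A = {s \<in> S. e s \<noteq> 0}"
  have A: "finite A" "A \<noteq> {}" using assms(1) \<open>s \<in> S\<close> \<open>e s \<noteq> 0\<close> by (auto simp: A_def)
  have "Max (\<delta> ` A) \<in> \<delta> ` A" using A by (intro Max_in) auto
  then obtain u where u: "u \<in> A" "\<delta> u = Max (\<delta> ` A)" by auto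
  then have u_max: "\<delta> v \<le> \<delta> u" if "v \<in> A" for v using A that by simp
  have "0 = coeff (\<Sum>s\<in>S. Polynomial.smult (e s) (g s)) (\<delta> u)" using zero by simp
  also have "\<dots> = (\<Sum>s\<in>S. e s * coeff (g s) (\<delta> u))" by (simp add: coeff_sum)
  also have "\<dots> = e u * coeff (g u) (\<delta> u) + (\<Sum>s\<in>S - {u}. e s * coeff (g s) (\<delta> u))"
    using assms(1) u(1) by (intro sum.remove) (auto simp: A_def)
  also have "(\<Sum>s\<in>S - {u}. e s * coeff (g s) (\<delta> u)) = 0"
  proof (intro sum.neutral ballI)
    fix v assume v: "v \<in> S - {u}"
    show "e v * coeff (g v) (\<delta> u) = 0"
    proof (cases "v \<in> A")
      case True
      have "\<delta> v \<noteq> \<delta> u" using assms(2) v u(1) by (auto simp: A_def inj_on_def)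
      then have "degree (g v) < \<delta> u" using deg(1)[of v] u_max[OF True] v by simp
      then show ?thesis by (simp add: coeff_eq_0)
    qed (use v in \<open>auto simp: A_def\<close>)
  qed
  finally show False using u(1) deg(2)[of u] by (auto simp: A_def)
qed

lemma odd_dvd_double_imp_eq_0:
  fixes N :: nat and r :: int
  assumes "odd N" "int N dvd 2 * r" "\<bar>r\<bar> < int N"
  shows "r = 0"
proof -
  have "coprime (int N) 2" using assms(1) by simp
  then have "int N dvd r" using assms(2) by (simp add: coprime_dvd_mult_right_iff)
  then show ?thesis using assms(3) by (rule dvd_imp_eq_0_int)
qed

text \<open>
  The pairs with \<open>a - b\<close> in a fixed residue class modulo \<open>2m + 1\<close> have distinct sums \<open>a + b\<close>, so
  the associated polynomials have distinct degrees; and the Chebyshev indices that occur in them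
  satisfy the hypothesis of \<open>cheb_U_independent\<close>.
\<close>

lemma ridge_poly_class_independent:
  fixes m :: nat and t :: "nat \<Rightarrow> real" and e :: "nat \<times> nat \<Rightarrow> real" and \<rho> :: int
  defines "S \<equiv> {(a, b). a + b \<le> 2 * m \<and> int (2 * m + 1) dvd (int a - int b) - \<rho>}"
  assumes "poly (cheb_U (2 * m)) (t 0) \<noteq> 0"
    and "\<And>j. j \<in> {1..m} \<Longrightarrow> t j = cos (2 * real j * pi / (2 * real m + 1))"
    and zero: "\<And>l. l \<le> m \<Longrightarrow>
      (\<Sum>(a, b)\<in>S. e (a, b) * poly (ridge_poly (max a b) (min a b)) (t l)) = 0"
    and "s \<in> S"
  shows "e s = 0"
proof -
  define N where "N = 2 * m + 1"
  define g where "g = (\<lambda>(a, b). ridge_poly (max a b) (min a b))"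
  define K where "K = (\<lambda>(a :: nat, b). {k. max a b \<le> k + min a b \<and> k \<le> a + b \<and> even (k + a + b)})"
  define p where "p = (\<Sum>s\<in>S. Polynomial.smult (e s) (g s))"
  have finS: "finite S" by (rule finite_subset[of _ "{..2 * m} \<times> {..2 * m}"]) (auto simp: S_def)
  have max_min: "max a b + min a b = a + b" for a b :: nat by simp
  have class_diff: "int N dvd (int a - int b) - (int a' - int b')"
    if "(a, b) \<in> S" "(a', b') \<in> S" for a b a' b'
  proof -
    have "int N dvd (int a - int b - \<rho>) - (int a' - int b' - \<rho>)"
      using that by (intro dvd_diff[of "int N" "int a - int b - \<rho>" "int a' - int b' - \<rho>"]) (simp_all add: S_def N_def)
    then show ?thesis by (simp only: diff_diff_eq2 diff_add_cancel)
  qed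
  have K: "(\<Union>s\<in>S. K s) \<subseteq> {..2 * m}" by (auto simp: S_def K_def)
  have gK: "g s \<in> U_span (\<Union>s\<in>S. K s)" if "s \<in> S" for s
  proof (rule U_span_mono)
    obtain a b where s: "s = (a, b)" by fastforce
    show "g s \<in> U_span (K s)"
      using ridge_poly_in_U_span[of "min a b" "max a b"]
      by (simp add: s g_def K_def max_min add.assoc)
    show "finite (\<Union>s\<in>S. K s)" using K by (rule finite_subset) simp
  qed (use that in auto)
  \<comment> \<open>The hypothesis gives zeros at the nodes only; the restriction on the Chebyshev
    indices turns this into an identity of polynomials, to which the degree argument
    applies.\<close>
  have "p = 0"
  proof (rule U_span_eq_0[OF assms(2,3) K])
    fix k l assume kl: "k \<in> (\<Union>s\<in>S. K s)" "l \<in> (\<Union>s\<in>S. K s)"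
    then obtain a b a' b' where ab: "(a, b) \<in> S" "k \<in> K (a, b)" "(a', b') \<in> S" "l \<in> K (a', b')"
      by auto
    \<comment> \<open>If \<open>k + l = 2 * m - 1\<close>, then
      \<open>\<bar>r\<bar> \<le> k + l < N\<close> forces \<open>r = 0\<close>. Hence
      \<open>a - b = a' - b'\<close>, so \<open>k\<close> and \<open>l\<close> have the same parity,
      whereas their sum is odd.\<close>
    define r where "r = (int a - int b) - (int a' - int b')"
    show "Suc (k + l) \<noteq> 2 * m"
    proof
      assume *: "Suc (k + l) = 2 * m"
      have "int N dvd r" using class_diff[OF ab(1,3)] by (simp add: r_def)
      moreover have "\<bar>r\<bar> < int N"
      proof -
        have "\<bar>int a - int b\<bar> \<le> int k" "\<bar>int a' - int b'\<bar> \<le> int l"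
          using ab(2,4) by (auto simp: K_def max_def min_def split: if_splits)
        then show ?thesis using * by (simp add: r_def N_def)
      qed
      ultimately have "r = 0" by (rule dvd_imp_eq_0_int)
      then have "a + b' = a' + b" by (simp add: r_def)
      moreover have "even (k + a + b)" "even (l + a' + b')" using ab(2,4) by (auto simp: K_def)
      ultimately have "even ((k + a + b) + (l + a' + b'))" by simp
      also have "(k + a + b) + (l + a' + b') = (k + l) + 2 * (a' + b)"
        using \<open>a + b' = a' + b\<close> by simp
      finally have "even (k + l)" by simp
      then have "odd (Suc (k + l))" by simp
      then show False unfolding * by simp
    qed
  next
    show "p \<in> U_span (\<Union>s\<in>S. K s)"
      unfolding p_def by (intro U_span_sum U_span_smult gK)
  next
    fix l assume "l \<le> m"
    then show "poly p (t l) = 0"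
      using zero by (simp add: p_def g_def poly_sum case_prod_unfold)
  qed
  show ?thesis
  proof (rule smult_sum_degree_inj_eq_0[OF finS _ _ _ \<open>p = 0\<close>[unfolded p_def] \<open>s \<in> S\<close>])
    \<comment> \<open>For equal sums the difference of the two values of \<open>a - b\<close> is
      \<open>2 * (a - a')\<close>; since \<open>N\<close> is odd, \<open>N\<close> divides
      \<open>a - a'\<close>, which is smaller in absolute value.\<close>
    show "inj_on (\<lambda>(a, b). a + b) S"
    proof (rule inj_onI, clarify)
      fix a b a' b' assume ab: "(a, b) \<in> S" "(a', b') \<in> S" "a + b = a' + b'"
      have "int a - int b - (int a' - int b') = 2 * (int a - int a')" using ab(3) by simp
      then have "int N dvd 2 * (int a - int a')" using class_diff[OF ab(1,2)] by (simp only:)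
      moreover have "\<bar>int a - int a'\<bar> < int N" using ab by (auto simp: S_def N_def)
      ultimately have "int a - int a' = 0"
        by (intro odd_dvd_double_imp_eq_0[of N]) (simp_all add: N_def)
      then show "a = a' \<and> b = b'" using ab(3) by simp
    qed
  next
    fix s :: "nat \<times> nat"
    obtain a b where s: "s = (a, b)" by fastforce
    show "degree (g s) \<le> (case s of (a, b) \<Rightarrow> a + b)"
      using degree_ridge_poly_le[of "max a b" "min a b"] by (simp add: s g_def)
    show "coeff (g s) (case s of (a, b) \<Rightarrow> a + b) \<noteq> 0"
      using coeff_ridge_poly[of "max a b" "min a b", unfolded max_min] by (simp add: s g_def)
  qed
qed

section \<open>Radon projections of polynomials\<close>

text \<open>Polynomial functions in the coordinates \<open>z\<close> and \<open>cnj z\<close>, in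
  which a rotation acts on every monomial by a scalar. Only existence of the coefficients is
  asserted.\<close>

definition bipoly :: "nat \<Rightarrow> (complex \<Rightarrow> complex) \<Rightarrow> bool" where
  "bipoly n f \<longleftrightarrow>
    (\<exists>d. \<forall>z. f z = (\<Sum>(a, b)\<in>{(a, b). a + b \<le> n}. d a b * (z ^ a * cnj z ^ b)))"

lemma finite_sum_le: "finite {(a, b). a + b \<le> (n :: nat)}"
  by (rule finite_subset[of _ "{..n} \<times> {..n}"]) auto

lemma bipoly_monom:
  assumes "a + b \<le> n"
  shows "bipoly n (\<lambda>z. z ^ a * cnj z ^ b)"
proof -
  have "z ^ a * cnj z ^ b = (\<Sum>(a', b')\<in>{(a, b). a + b \<le> n}.
      (if (a', b') = (a, b) then 1 else 0) * (z ^ a' * cnj z ^ b'))" for z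
  proof -
    have "(\<Sum>(a', b')\<in>{(a, b). a + b \<le> n}.
        (if (a', b') = (a, b) then 1 else 0) * (z ^ a' * cnj z ^ b'))
      = (\<Sum>s\<in>{(a, b). a + b \<le> n}. if s = (a, b) then z ^ a * cnj z ^ b else 0)"
      by (intro sum.cong) (auto split: if_splits)
    also have "\<dots> = z ^ a * cnj z ^ b"
      using assms by (subst sum.delta[OF finite_sum_le]) auto
    finally show ?thesis by simp
  qed
  then show ?thesis unfolding bipoly_def
    by (intro exI[of _ "\<lambda>a' b'. if (a', b') = (a, b) then 1 else 0"]) blast
qed

lemma bipoly_add: "bipoly n f \<Longrightarrow> bipoly n g \<Longrightarrow> bipoly n (\<lambda>z. f z + g z)"
proof -
  assume "bipoly n f" "bipoly n g"
  then obtain c d where "\<forall>z. f z = (\<Sum>(a, b)\<in>{(a, b). a + b \<le> n}. c a b * (z ^ a * cnj z ^ b))"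
      "\<forall>z. g z = (\<Sum>(a, b)\<in>{(a, b). a + b \<le> n}. d a b * (z ^ a * cnj z ^ b))"
    unfolding bipoly_def by blast
  then have "\<forall>z. f z + g z = (\<Sum>(a, b)\<in>{(a, b). a + b \<le> n}. (c a b + d a b) * (z ^ a * cnj z ^ b))"
    by (simp only: case_prod_unfold distrib_right sum.distrib simp_thms)
  then show ?thesis unfolding bipoly_def by (rule exI[of _ "\<lambda>a b. c a b + d a b"])
qed

lemma bipoly_cmult: "bipoly n f \<Longrightarrow> bipoly n (\<lambda>z. c * f z)"
proof -
  assume "bipoly n f"
  then obtain d where "\<forall>z. f z = (\<Sum>(a, b)\<in>{(a, b). a + b \<le> n}. d a b * (z ^ a * cnj z ^ b))"
    unfolding bipoly_def by blast
  then have "\<forall>z. c * f z = (\<Sum>(a, b)\<in>{(a, b). a + b \<le> n}. (c * d a b) * (z ^ a * cnj z ^ b))"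
    by (simp only: sum_distrib_left mult.assoc case_prod_unfold simp_thms)
  then show ?thesis unfolding bipoly_def by (rule exI[of _ "\<lambda>a b. c * d a b"])
qed

lemma bipoly_0: "bipoly n (\<lambda>_. 0)"
  unfolding bipoly_def by (rule exI[of _ "\<lambda>_ _. 0"]) simp

lemma bipoly_sum: "(\<And>i. i \<in> I \<Longrightarrow> bipoly n (f i)) \<Longrightarrow> bipoly n (\<lambda>z. \<Sum>i\<in>I. f i z)"
  by (induction I rule: infinite_finite_induct) (auto intro: bipoly_0 bipoly_add)

lemma bipoly_mult_linear:
  assumes "bipoly n f"
  shows "bipoly (Suc n) (\<lambda>z. (\<alpha> * z + \<beta> * cnj z) * f z)"
proof -
  obtain d where d: "\<And>z. f z = (\<Sum>(a, b)\<in>{(a, b). a + b \<le> n}. d a b * (z ^ a * cnj z ^ b))"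
    using assms unfolding bipoly_def by blast
  have "(\<lambda>z. (\<alpha> * z + \<beta> * cnj z) * f z) = (\<lambda>z. \<Sum>s\<in>{(a, b). a + b \<le> n}.
      \<alpha> * d (fst s) (snd s) * (z ^ Suc (fst s) * cnj z ^ snd s)
      + \<beta> * d (fst s) (snd s) * (z ^ fst s * cnj z ^ Suc (snd s)))"
    unfolding d sum_distrib_left case_prod_unfold
    by (intro ext sum.cong refl) (simp add: algebra_simps)
  then show ?thesis
    by (simp only:) (intro bipoly_sum bipoly_add bipoly_cmult bipoly_monom; auto)
qed

lemma bipoly_mono: "bipoly k f \<Longrightarrow> k \<le> n \<Longrightarrow> bipoly n f"
proof -
  assume f: "bipoly k f" "k \<le> n"
  then obtain d where "\<And>z. f z = (\<Sum>s\<in>{(a, b). a + b \<le> k}.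
      d (fst s) (snd s) * (z ^ fst s * cnj z ^ snd s))"
    unfolding bipoly_def case_prod_unfold by auto
  then have "f = (\<lambda>z. \<Sum>s\<in>{(a, b). a + b \<le> k}. d (fst s) (snd s) * (z ^ fst s * cnj z ^ snd s))"
    by blast
  then show ?thesis
    by (simp only:) (intro bipoly_sum bipoly_cmult bipoly_monom; use f(2) in auto)
qed

text \<open>\<open>Re z\<close> and \<open>Im z\<close> are linear forms in \<open>z\<close> and
  \<open>cnj z\<close>, so every factor raises the degree by one; the powers are built up by two
  inductions.\<close>

lemma bipoly_Re_Im_power: "bipoly (i + j) (\<lambda>z. of_real (Im z) ^ i * of_real (Re z) ^ j)"
proof -
  have Re: "of_real (Re z) = 1 / 2 * z + 1 / 2 * cnj z" for z
    by (simp add: complex_eq_iff)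
  have Im: "of_real (Im z) = - \<i> / 2 * z + \<i> / 2 * cnj z" for z
    by (simp add: complex_eq_iff)
  have j: "bipoly j (\<lambda>z. of_real (Re z) ^ j)"
  proof (induction j)
    case 0
    then show ?case using bipoly_monom[of 0 0 0] by simp
  next
    case (Suc j)
    then show ?case using bipoly_mult_linear[OF Suc.IH, of "1 / 2" "1 / 2"] by (simp only: Re[symmetric] power_Suc)
  qed
  show ?thesis
  proof (induction i)
    case (Suc i)
    then show ?case using bipoly_mult_linear[OF Suc.IH, of "- \<i> / 2" "\<i> / 2"]
      by (simp only: Im[symmetric] power_Suc mult.assoc add_Suc)
  qed (use j in simp)
qed

lemma Pi2_bipoly:
  assumes "P \<in> Pi2 n"
  shows "bipoly n (\<lambda>z. of_real (eval2 P (Re z, Im z)))"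
proof -
  \<comment> \<open>The sum over degrees also meets monomials with coefficient zero, for which
    \<open>Pi2\<close> gives no degree bound; they are treated apart.\<close>
  have "bipoly n (\<lambda>z. of_real (coeff (coeff P i) j) * (of_real (Im z) ^ i * of_real (Re z) ^ j))" for i j
  proof (cases "coeff (coeff P i) j = 0")
    case True
    then show ?thesis using bipoly_0 by simp
  next
    case False
    then have "i + j \<le> n" using assms by (auto simp: Pi2_def)
    then show ?thesis by (intro bipoly_cmult bipoly_mono[OF bipoly_Re_Im_power])
  qed
  then have "bipoly n (\<lambda>z. \<Sum>i\<le>degree P. \<Sum>j\<le>degree (coeff P i).
      of_real (coeff (coeff P i) j) * (of_real (Im z) ^ i * of_real (Re z) ^ j))"
    by (intro bipoly_sum)
  then show ?thesis by (simp add: eval2_altdef mult_ac)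
qed

text \<open>For fixed \<open>y\<close> the polynomial in \<open>x\<close> has only zero values and
  hence is zero. Thus \<open>P\<close>, as a polynomial over the domain of real polynomials, has all
  the constants \<open>[:y:]\<close> as roots.\<close>

lemma eval2_eq_0_imp_eq_0:
  assumes "\<And>x y. eval2 P (x, y) = 0"
  shows "P = 0"
proof -
  have "poly P [:y:] = 0" for y
    using assms by (intro poly_all_0_iff_0[THEN iffD1]) (simp add: eval2_def)
  then have "range (\<lambda>y. [:y:]) \<subseteq> {x. poly P x = 0}" by auto
  moreover have "infinite (range (\<lambda>y :: real. [:y:]))"
    by (subst finite_image_iff) (auto simp: inj_on_def infinite_UNIV_char_0)
  ultimately show ?thesis using poly_roots_finite finite_subset by blast
qed

text \<open>The point with parameter \<open>s\<close> on the line is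
  \<open>cis \<theta> * (cos \<phi> + \<i> s)\<close>. Rotating back to the chord
  \<open>Re z = cos \<phi>\<close> costs the monomial the factor
  \<open>cis ((a - b) * \<theta>)\<close>.\<close>

lemma has_integral_radon_aux:
  assumes d: "\<And>z. of_real (eval2 P (Re z, Im z))
      = (\<Sum>(a, b)\<in>{(a, b). a + b \<le> n}. d a b * (z ^ a * cnj z ^ b))"
    and "sin \<phi> > 0"
  shows "((\<lambda>s. complex_of_real (eval2 P (cos \<phi> * cos \<theta> - s * sin \<theta>, cos \<phi> * sin \<theta> + s * cos \<theta>)))
      has_integral of_real (sin \<phi>) * (\<Sum>(a, b)\<in>{(a, b). a + b \<le> n}. d a b
        * of_real (poly (ridge_poly (max a b) (min a b)) (cos \<phi>)) * cis ((real a - real b) * \<theta>)))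
      {- sin \<phi>..sin \<phi>}"
proof -
  define w where "w s = Complex (cos \<phi>) s" for s
  have z: "z ^ a * cnj z ^ b = cis ((real a - real b) * \<theta>) * (w s ^ a * cnj (w s) ^ b)"
    if "z = cis \<theta> * w s" for z s a b
  proof -
    have "cis ((real a - real b) * \<theta>) = cis \<theta> ^ a * cnj (cis \<theta>) ^ b"
      by (simp add: Complex.DeMoivre cis_cnj cis_mult algebra_simps)
    then show ?thesis unfolding that by (simp add: power_mult_distrib mult_ac)
  qed
  have "complex_of_real (eval2 P (cos \<phi> * cos \<theta> - s * sin \<theta>, cos \<phi> * sin \<theta> + s * cos \<theta>))
      = (\<Sum>(a, b)\<in>{(a, b). a + b \<le> n}.
          d a b * cis ((real a - real b) * \<theta>) * (w s ^ a * cnj (w s) ^ b))" for s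
  proof -
    have "(cos \<phi> * cos \<theta> - s * sin \<theta>, cos \<phi> * sin \<theta> + s * cos \<theta>)
        = (Re (cis \<theta> * w s), Im (cis \<theta> * w s))"
      by (simp add: w_def algebra_simps)
    then show ?thesis by (simp only: d z mult.assoc)
  qed
  moreover have "((\<lambda>s. \<Sum>(a, b)\<in>{(a, b). a + b \<le> n}.
          d a b * cis ((real a - real b) * \<theta>) * (w s ^ a * cnj (w s) ^ b)) has_integral
      (\<Sum>(a, b)\<in>{(a, b). a + b \<le> n}. d a b * cis ((real a - real b) * \<theta>)
          * of_real (sin \<phi> * poly (ridge_poly (max a b) (min a b)) (cos \<phi>)))) {- sin \<phi>..sin \<phi>}"
    unfolding w_def case_prod_unfold
    by (intro has_integral_sum finite_sum_le[unfolded case_prod_unfold] has_integral_mult_right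
      has_integral_ridge_poly_max_min[OF assms(2)])
  moreover have "(\<Sum>(a, b)\<in>{(a, b). a + b \<le> n}. d a b * cis ((real a - real b) * \<theta>)
          * of_real (sin \<phi> * poly (ridge_poly (max a b) (min a b)) (cos \<phi>)))
      = of_real (sin \<phi>) * (\<Sum>(a, b)\<in>{(a, b). a + b \<le> n}. d a b
        * of_real (poly (ridge_poly (max a b) (min a b)) (cos \<phi>)) * cis ((real a - real b) * \<theta>))"
    unfolding sum_distrib_left case_prod_unfold by (intro sum.cong refl) (simp add: mult_ac)
  ultimately show ?thesis by simp
qed

text \<open>This supplies the integrability behind \<open>radon\<close>, whose definition uses
  \<open>integral\<close>; linearity in the polynomial depends on it.\<close>

lemma has_integral_radon:
  assumes "P \<in> Pi2 n" "sin \<phi> > 0"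
  shows "((\<lambda>s. eval2 P (cos \<phi> * cos \<theta> - s * sin \<theta>, cos \<phi> * sin \<theta> + s * cos \<theta>))
      has_integral radon \<theta> (eval2 P) (cos \<phi>)) {- sin \<phi>..sin \<phi>}"
proof -
  have "sqrt (1 - (cos \<phi>)\<^sup>2) = sin \<phi>"
    using assms(2) by (simp flip: sin_squared_eq)
  moreover obtain d where "\<And>z. of_real (eval2 P (Re z, Im z))
      = (\<Sum>(a, b)\<in>{(a, b). a + b \<le> n}. d a b * (z ^ a * cnj z ^ b))"
    using Pi2_bipoly[OF assms(1)] unfolding bipoly_def by blast
  from has_integral_Re[OF has_integral_radon_aux[OF this assms(2)]]
  have "(\<lambda>s. eval2 P (cos \<phi> * cos \<theta> - s * sin \<theta>, cos \<phi> * sin \<theta> + s * cos \<theta>))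
      integrable_on {- sin \<phi>..sin \<phi>}"
    unfolding Re_complex_of_real by (rule has_integral_integrable)
  ultimately show ?thesis unfolding radon_def by (simp add: integrable_integral)
qed

lemma Pi2_diff:
  assumes "P \<in> Pi2 n" "Q \<in> Pi2 n"
  shows "P - Q \<in> Pi2 n"
  unfolding Pi2_def
proof (intro CollectI allI impI)
  fix i j assume "coeff (coeff (P - Q) i) j \<noteq> 0"
  then have "coeff (coeff P i) j \<noteq> 0 \<or> coeff (coeff Q i) j \<noteq> 0" by auto
  then show "i + j \<le> n" using assms unfolding Pi2_def by blast
qed

lemma radon_diff:
  assumes "P \<in> Pi2 n" "Q \<in> Pi2 n" "sin \<phi> > 0"
  shows "radon \<theta> (eval2 (P - Q)) (cos \<phi>) = radon \<theta> (eval2 P) (cos \<phi>) - radon \<theta> (eval2 Q) (cos \<phi>)"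
proof -
  from has_integral_radon[OF Pi2_diff[OF assms(1,2)] assms(3)]
  have "((\<lambda>s. eval2 P (cos \<phi> * cos \<theta> - s * sin \<theta>, cos \<phi> * sin \<theta> + s * cos \<theta>)
        - eval2 Q (cos \<phi> * cos \<theta> - s * sin \<theta>, cos \<phi> * sin \<theta> + s * cos \<theta>))
      has_integral radon \<theta> (eval2 (P - Q)) (cos \<phi>)) {- sin \<phi>..sin \<phi>}"
    by (simp add: eval2_def)
  then show ?thesis
    by (rule has_integral_unique[OF _ has_integral_diff[OF has_integral_radon[OF assms(1,3)]
      has_integral_radon[OF assms(2,3)]]])
qed

section \<open>Recovery of a polynomial from its Radon projections\<close>

lemma radon_eq_0_imp_eq_0:
  fixes m :: nat and t :: "nat \<Rightarrow> real"
  assumes t0: "t 0 \<in> {-1<..<1}" "poly (cheb_U (2 * m)) (t 0) \<noteq> 0"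
    and tj: "\<And>j. j \<in> {1..m} \<Longrightarrow> t j = cos (2 * real j * pi / (2 * real m + 1))"
    and P: "P \<in> Pi2 (2 * m)"
    and zero: "\<And>j k. j \<le> 2 * m \<Longrightarrow> k \<le> m \<Longrightarrow> radon (phi m j) (eval2 P) (t k) = 0"
  shows "P = 0"
proof -
  define N where "N = 2 * m + 1"
  define T where "T = {(a, b). a + b \<le> 2 * m}"
  define g where "g = (\<lambda>(a, b). ridge_poly (max a b) (min a b))"
  define \<nu> where "\<nu> = (\<lambda>(a, b). int a - int b)"
  obtain d where d: "\<And>z. of_real (eval2 P (Re z, Im z))
      = (\<Sum>(a, b)\<in>{(a, b). a + b \<le> 2 * m}. d a b * (z ^ a * cnj z ^ b))"
    using Pi2_bipoly[OF P] unfolding bipoly_def by blast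
  \<comment> \<open>At a fixed node the data for the \<open>N\<close> directions are a discrete
    Fourier transform in \<open>j\<close> with frequencies \<open>a - b\<close>, once the positive
    factor \<open>sin \<phi>\<close> is cancelled.\<close>
  have class_0: "(\<Sum>s\<in>{s\<in>T. int N dvd \<nu> s - \<rho>}. d (fst s) (snd s) * of_real (poly (g s) (t l))) = 0"
    if "l \<le> m" for l \<rho>
  proof (rule discrete_fourier_inversion)
    fix j assume "j < N"
    obtain \<phi> where \<phi>: "t l = cos \<phi>" "sin \<phi> > 0" using node_eq_cos[OF t0(1) tj \<open>l \<le> m\<close>] by blast
    have "of_real (radon (phi m j) (eval2 P) (cos \<phi>)) = of_real (sin \<phi>) * (\<Sum>(a, b)\<in>T. d a b
        * of_real (poly (ridge_poly (max a b) (min a b)) (cos \<phi>)) * cis ((real a - real b) * phi m j))"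
      unfolding T_def
      by (rule has_integral_unique[OF has_integral_of_real[OF has_integral_radon[OF P \<phi>(2)]]
        has_integral_radon_aux[OF d \<phi>(2)]])
    moreover have "radon (phi m j) (eval2 P) (cos \<phi>) = 0"
      using zero[of j l] \<open>j < N\<close> that by (simp add: N_def \<phi>(1))
    ultimately have "(\<Sum>(a, b)\<in>T. d a b
        * of_real (poly (ridge_poly (max a b) (min a b)) (t l)) * cis ((real a - real b) * phi m j)) = 0"
      using \<phi> by simp
    moreover have "(real a - real b) * phi m j = 2 * pi * of_int (\<nu> (a, b)) * real j / real N" for a b
      by (simp add: phi_def \<nu>_def N_def mult_ac add_ac)
    ultimately show "(\<Sum>s\<in>T. d (fst s) (snd s) * of_real (poly (g s) (t l))
        * cis (2 * pi * of_int (\<nu> s) * real j / real N)) = 0"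
      by (simp add: g_def case_prod_unfold)
  qed (simp_all add: N_def T_def finite_sum_le)
  have d0: "d a b = 0" if "(a, b) \<in> T" for a b
  proof -
    define S where "S = {(a', b'). a' + b' \<le> 2 * m
      \<and> int (2 * m + 1) dvd (int a' - int b') - (int a - int b)}"
    have S: "S = {s\<in>T. int N dvd \<nu> s - (int a - int b)}"
      by (auto simp: S_def T_def \<nu>_def N_def)
    have ab: "(a, b) \<in> S" using that by (simp add: S_def T_def)
    \<comment> \<open>The coefficients \<open>d\<close> are complex and the ridge polynomials real,
      so the real and imaginary parts satisfy the class equations separately. The class taken is
      that of \<open>a - b\<close> itself.\<close>
    have "Re (d (fst (a, b)) (snd (a, b))) = 0"
    proof (rule ridge_poly_class_independent[OF t0(2) tj, where e = "\<lambda>s. Re (d (fst s) (snd s))"])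
      fix l assume "l \<le> m"
      from arg_cong[OF class_0[OF this, of "int a - int b"], of Re]
      have "(\<Sum>s\<in>S. Re (d (fst s) (snd s)) * poly (g s) (t l)) = 0"
        by (simp add: S)
      then show "(\<Sum>(a, b)\<in>{(a', b'). a' + b' \<le> 2 * m \<and> int (2 * m + 1) dvd (int a' - int b') - (int a - int b)}.
          Re (d (fst (a, b)) (snd (a, b))) * poly (ridge_poly (max a b) (min a b)) (t l)) = 0"
        by (simp add: S_def g_def case_prod_unfold)
    qed (use ab in \<open>auto simp: S_def\<close>)
    moreover have "Im (d (fst (a, b)) (snd (a, b))) = 0"
    proof (rule ridge_poly_class_independent[OF t0(2) tj, where e = "\<lambda>s. Im (d (fst s) (snd s))"])
      fix l assume "l \<le> m"
      from arg_cong[OF class_0[OF this, of "int a - int b"], of Im]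
      have "(\<Sum>s\<in>S. Im (d (fst s) (snd s)) * poly (g s) (t l)) = 0"
        by (simp add: S)
      then show "(\<Sum>(a, b)\<in>{(a', b'). a' + b' \<le> 2 * m \<and> int (2 * m + 1) dvd (int a' - int b') - (int a - int b)}.
          Im (d (fst (a, b)) (snd (a, b))) * poly (ridge_poly (max a b) (min a b)) (t l)) = 0"
        by (simp add: S_def g_def case_prod_unfold)
    qed (use ab in \<open>auto simp: S_def\<close>)
    ultimately show ?thesis by (simp add: complex_eq_iff)
  qed
  have "eval2 P (x, y) = 0" for x y
  proof -
    have "complex_of_real (eval2 P (Re (Complex x y), Im (Complex x y))) = 0"
      unfolding d using d0 by (intro sum.neutral) (auto simp: T_def)
    then show ?thesis by simp
  qed
  then show ?thesis by (rule eval2_eq_0_imp_eq_0)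
qed

theorem theorem2p11:
  fixes m :: nat and t :: "nat \<Rightarrow> real"
  assumes "m \<ge> 1"
    and "t 0 \<in> {-1<..<1}"
    and "poly (cheb_U (2 * m)) (t 0) \<noteq> 0"
    and "\<And>j. j \<in> {1..m} \<Longrightarrow> t j = cos (2 * real j * pi / (2 * real m + 1))"
  shows "(\<forall>j\<in>{1..m - 1}. invertible_mat (Xi_mat m j t)) \<and>
    (\<forall>P\<in>Pi2 (2 * m). \<forall>Q\<in>Pi2 (2 * m).
      (\<forall>j\<in>{0..2 * m}. \<forall>k\<in>{0..m}.
        radon (phi m j) (eval2 P) (t k) = radon (phi m j) (eval2 Q) (t k)) \<longrightarrow> P = Q)"
proof (intro conjI ballI impI)
  fix j assume "j \<in> {1..m - 1}"
  then show "invertible_mat (Xi_mat m j t)" using assms(3,4) by (intro invertible_Xi_mat) auto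
next
  fix P Q
  assume P: "P \<in> Pi2 (2 * m)" and Q: "Q \<in> Pi2 (2 * m)"
    and eq: "\<forall>j\<in>{0..2 * m}. \<forall>k\<in>{0..m}.
      radon (phi m j) (eval2 P) (t k) = radon (phi m j) (eval2 Q) (t k)"
  \<comment> \<open>By linearity of the projections, equal data for \<open>P\<close> and
    \<open>Q\<close> become zero data for the difference.\<close>
  have "P - Q = 0"
  proof (rule radon_eq_0_imp_eq_0[OF assms(2-4)])
    show "P - Q \<in> Pi2 (2 * m)" by (rule Pi2_diff[OF P Q])
  next
    fix j k assume "j \<le> 2 * m" "k \<le> m"
    obtain \<phi> where "t k = cos \<phi>" "sin \<phi> > 0"
      using node_eq_cos[OF assms(2,4) \<open>k \<le> m\<close>] by blast
    then have "radon (phi m j) (eval2 (P - Q)) (t k)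
        = radon (phi m j) (eval2 P) (t k) - radon (phi m j) (eval2 Q) (t k)"
      using radon_diff[OF P Q, of \<phi> "phi m j"] by simp
    also have "radon (phi m j) (eval2 P) (t k) = radon (phi m j) (eval2 Q) (t k)"
      using eq \<open>j \<le> 2 * m\<close> \<open>k \<le> m\<close> by simp
    finally show "radon (phi m j) (eval2 (P - Q)) (t k) = 0" by simp
  qed
  then show "P = Q" by simp
qed

end
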